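(* (1) The element $\{1\}$ is a cancellative prime element of $\mathcal P_{\mathrm{fin}}(\mathbb N_0)$, and consequently $\mathcal P_{\mathrm{fin}}(\mathbb N_0)=\{\{k\}\colon k\in\mathbb N_0\}\oplus\mathcal P_{\mathrm{fin},0}(\mathbb N_0)$. No element of $\mathcal P_{\mathrm{fin}}(\mathbb N_0)$ other than $\{1\}$ is prime. (2) If $\mathcal P_{\mathrm{fin},0}(\mathbb N_0)=H_1\oplus H_2$ for submonoids $H_1,H_2$, then $H_1=\{\{0\}\}$ or $H_2=\{\{0\}\}$.
   Context: $\mathcal P_{\mathrm{fin}}(\mathbb N_0)$ is the set of all finite nonempty subsets of $\mathbb N_0$ with set addition $A+B=\{a+b\colon a\in A,b\in B\}$; its identity element is $\{0\}$, which is its only invertible element. $\mathcal P_{\mathrm{fin},0}(\mathbb N_0)$ is the submonoid of those finite nonempty subsets containing $0$. In such a monoid $H$, $A$ divides $B$ if $B=A+C$ for some $C\in H$. An element $P$ is prime if $P\ne\{0\}$ and whenever $P$ divides $A+B$ then $P$ divides $A$ or $P$ divides $B$. An element $A$ is cancellative if $A+B=A+C$ implies $B=C$. For submonoids $H_1,H_2$ of a monoid $H$, $H=H_1\oplus H_2$ means that every element of $H$ can be written uniquely as $h_1+h_2$ with $h_1\in H_1$, $h_2\in H_2$. *)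

theory Defs
  imports "HOL-Algebra.Divisibility" "HOL-Library.Set_Algebras"
begin

text \<open>
  Here + on sets is the Minkowski sum from \<^theory>\<open>HOL-Library.Set_Algebras\<close>.
\<close>

definition Pfin :: "nat set monoid" where
  "Pfin = \<lparr>carrier = {A. finite A \<and> A \<noteq> {}}, mult = (+), one = {0}\<rparr>"

definition Pfin0 :: "nat set monoid" where
  "Pfin0 = Pfin\<lparr>carrier := {A \<in> carrier Pfin. 0 \<in> A}\<rparr>"

definition cancellative :: "('a, 'b) monoid_scheme \<Rightarrow> 'a \<Rightarrow> bool" where
  "cancellative G a \<longleftrightarrow>
     (\<forall>b\<in>carrier G. \<forall>c\<in>carrier G. a \<otimes>\<^bsub>G\<^esub> b = a \<otimes>\<^bsub>G\<^esub> c \<longrightarrow> b = c)"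

definition internal_direct_sum :: "('a, 'b) monoid_scheme \<Rightarrow> 'a set \<Rightarrow> 'a set \<Rightarrow> bool" where
  "internal_direct_sum G H\<^sub>1 H\<^sub>2 \<longleftrightarrow>
     submonoid H\<^sub>1 G \<and> submonoid H\<^sub>2 G \<and>
     (\<forall>h\<in>carrier G. \<exists>!p. p \<in> H\<^sub>1 \<times> H\<^sub>2 \<and> h = fst p \<otimes>\<^bsub>G\<^esub> snd p)"

lemma sum_in_Pfin:
  fixes A B :: "nat set"
  assumes "finite A" "A \<noteq> {}" "finite B" "B \<noteq> {}"
  shows "finite (A + B) \<and> A + B \<noteq> {}"
  using assms by (auto simp: set_plus_def)

lemma comm_monoid_Pfin: "comm_monoid Pfin"
  by (rule comm_monoidI) (simp_all add: Pfin_def sum_in_Pfin ac_simps)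

lemma submonoid_Pfin0: "submonoid (carrier Pfin0) Pfin"
  by (rule submonoid.intro)
    (use set_plus_intro[of 0 _ 0] in \<open>force simp: Pfin_def Pfin0_def sum_in_Pfin\<close>)+

text \<open>
  The notion of primality from \<^theory>\<open>HOL-Algebra.Divisibility\<close> excludes all units; in
  \<^const>\<open>Pfin\<close> this excludes exactly the identity.
\<close>

lemma Units_Pfin: "Units Pfin = {{0}}"
proof
  show "Units Pfin \<subseteq> {{0}}"
  proof
    fix B assume "B \<in> Units Pfin"
    then obtain A where *: "A \<noteq> {}" "B \<noteq> {}" "A + B = {0}"
      by (auto simp: Units_def Pfin_def)
    have "b = 0" if "b \<in> B" for b
    proof -
      obtain a where "a \<in> A" using * by blast
      then have "a + b \<in> A + B" using that by (rule set_plus_intro)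
      then show "b = 0" using * by simp
    qed
    then show "B \<in> {{0}}" using * by blast
  qed
  show "{{0}} \<subseteq> Units Pfin"
    by (auto simp: Units_def Pfin_def intro!: exI[of _ "{0}"])
qed

end

theory Submission
  imports Defs
begin

text \<open>
  Everything rests on the absorption identity \<open>A + {0..n} = {0..2n}\<close>, valid for every \<open>A\<close> with
  \<open>0 \<in> A\<close> and maximum \<open>n\<close>, together with the fact that \<open>{0..n}\<close> is the \<open>n\<close>-fold sum of \<open>{0,1}\<close>.
  A prime \<open>P\<close> containing \<open>0\<close> thus divides a multiple of \<open>{0,1}\<close>, so \<open>P = {0,1}\<close>; but \<open>{0,1}\<close>
  divides \<open>{0,1,3} + {0,2,3} = {0..6}\<close> and neither summand. A prime without \<open>0\<close> is divisible
  by \<open>{1}\<close> and then equals it. In a direct decomposition the irreducible element \<open>{0,1}\<close> lies in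
  one of the summands, hence so do all intervals; an element \<open>A\<close> of the other summand satisfies
  \<open>{0..n} + A = {0..2n} + {0}\<close>, and uniqueness of representations forces \<open>A = {0}\<close>.
\<close>

section \<open>Carriers, divisibility and translates by singletons\<close>

lemma carrier_Pfin [simp]: "A \<in> carrier Pfin \<longleftrightarrow> finite A \<and> A \<noteq> {}"
  by (simp add: Pfin_def)

lemma mult_Pfin [simp]: "A \<otimes>\<^bsub>Pfin\<^esub> B = A + B"
  by (simp add: Pfin_def)

lemma carrier_Pfin0 [simp]: "A \<in> carrier Pfin0 \<longleftrightarrow> finite A \<and> 0 \<in> A"
  by (auto simp: Pfin0_def)

lemma mult_Pfin0 [simp]: "A \<otimes>\<^bsub>Pfin0\<^esub> B = A + B"
  by (simp add: Pfin0_def Pfin_def)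

lemma one_Pfin0 [simp]: "\<one>\<^bsub>Pfin0\<^esub> = {0}"
  by (simp add: Pfin0_def Pfin_def)

lemma divides_Pfin:
  "A divides\<^bsub>Pfin\<^esub> B \<longleftrightarrow> (\<exists>C. finite C \<and> C \<noteq> {} \<and> B = A + C)"
  by (simp add: factor_def Bex_def)

lemma prime_PfinD:
  assumes "prime Pfin P" "finite A" "A \<noteq> {}" "finite B" "B \<noteq> {}" "P divides\<^bsub>Pfin\<^esub> (A + B)"
  shows "P divides\<^bsub>Pfin\<^esub> A \<or> P divides\<^bsub>Pfin\<^esub> B"
  using assms by (auto simp: prime_def)

lemma singleton_set_plus: "{k} + A = (+) k ` A"
  by (auto simp: set_plus_def)

lemma singleton_set_plus_cancel:
  fixes k :: "'a::cancel_semigroup_add"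
  assumes "{k} + A = {k} + B"
  shows "A = B"
  using assms by (simp add: singleton_set_plus inj_image_eq_iff)

text \<open>The lower bound \<open>k\<close> makes the truncated subtraction exact, so translating
  by \<open>k\<close> undoes it.\<close>

lemma eq_singleton_set_plus:
  fixes A :: "nat set"
  assumes "\<And>a. a \<in> A \<Longrightarrow> k \<le> a"
  shows "A = {k} + (\<lambda>a. a - k) ` A"
  using assms by (force simp: singleton_set_plus image_image)

lemma singleton_divides_Pfin:
  assumes "finite A" "A \<noteq> {}"
  shows "{k} divides\<^bsub>Pfin\<^esub> A \<longleftrightarrow> (\<forall>a\<in>A. k \<le> a)"
proof
  assume "\<forall>a\<in>A. k \<le> a"
  then have "A = {k} + (\<lambda>a. a - k) ` A" by (intro eq_singleton_set_plus) simp
  with assms show "{k} divides\<^bsub>Pfin\<^esub> A"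
    unfolding divides_Pfin by blast
qed (auto simp: divides_Pfin singleton_set_plus)

section \<open>The prime \<open>{1}\<close> and the splitting off of singletons\<close>

lemma prime_Pfin_1: "prime Pfin {1}"
proof (rule primeI)
  show "{1} \<notin> Units Pfin" by (simp add: Units_Pfin)
next
  fix A B
  assume AB: "A \<in> carrier Pfin" "B \<in> carrier Pfin" and "{1} divides\<^bsub>Pfin\<^esub> A \<otimes>\<^bsub>Pfin\<^esub> B"
  then have "\<forall>s \<in> A + B. 1 \<le> s"
    using singleton_divides_Pfin sum_in_Pfin by auto
  \<comment> \<open>Divisibility by \<open>{1}\<close> means missing 0, and 0 lies in
    \<open>A + B\<close> as soon as it lies in both summands.\<close>
  then have "0 \<notin> A \<or> 0 \<notin> B" using set_plus_intro[of 0 A 0 B] by force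
  then have "(\<forall>a\<in>A. 1 \<le> a) \<or> (\<forall>b\<in>B. 1 \<le> b)"
    by (metis less_one not_less)
  with AB show "{1} divides\<^bsub>Pfin\<^esub> A \<or> {1} divides\<^bsub>Pfin\<^esub> B"
    by (simp add: singleton_divides_Pfin)
qed

lemma submonoid_singletons: "submonoid {{k} | k. k \<in> (UNIV :: nat set)} Pfin"
  by (rule submonoid.intro) (auto simp: singleton_set_plus, simp add: Pfin_def)

lemma Pfin_direct_sum:
  "internal_direct_sum Pfin {{k} | k. k \<in> (UNIV :: nat set)} (carrier Pfin0)"
  unfolding internal_direct_sum_def
proof (intro conjI ballI)
  fix A assume A: "A \<in> carrier Pfin"
  define B where "B = (\<lambda>a. a - Min A) ` A"
  have B: "finite B" "0 \<in> B"
    using A unfolding B_def by (simp, intro image_eqI[of _ _ "Min A"]) simp_all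
  have eq: "A = {Min A} + B"
    unfolding B_def using A by (intro eq_singleton_set_plus) simp
  have uniq: "k = Min A \<and> C = B" if "0 \<in> C" "A = {k} + C" for k C
  proof -
    \<comment> \<open>Since \<open>0 \<in> C\<close>, the least element of \<open>{k} + C\<close> is
      \<open>k\<close>; cancelling \<open>{k}\<close> then determines \<open>C\<close>.\<close>
    have "Min A = k"
      using A that by (intro Min_eqI) (auto simp: singleton_set_plus)
    with that(2) eq show ?thesis using singleton_set_plus_cancel[of k C B] by simp
  qed
  show "\<exists>!p. p \<in> {{k} | k. k \<in> UNIV} \<times> carrier Pfin0 \<and> A = fst p \<otimes>\<^bsub>Pfin\<^esub> snd p"
  proof (rule ex1I[of _ "({Min A}, B)"])
    show "({Min A}, B) \<in> {{k} | k. k \<in> UNIV} \<times> carrier Pfin0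
        \<and> A = fst ({Min A}, B) \<otimes>\<^bsub>Pfin\<^esub> snd ({Min A}, B)"
      using B eq by auto
  next
    fix p assume "p \<in> {{k} | k. k \<in> UNIV} \<times> carrier Pfin0 \<and> A = fst p \<otimes>\<^bsub>Pfin\<^esub> snd p"
    then obtain k C where "p = ({k}, C)" "0 \<in> C" "A = {k} + C" by auto
    with uniq show "p = ({Min A}, B)" by blast
  qed
qed (rule submonoid_singletons submonoid_Pfin0)+

section \<open>Intervals and absorption\<close>

lemma atMost_set_plus: "{..m} + {..n} = {..m + n :: nat}"
proof
  show "{..m + n} \<subseteq> {..m} + {..n}"
  proof
    fix x assume "x \<in> {..m + n}"
    \<comment> \<open>Fill the first summand up to \<open>m\<close>; the truncated difference is the
      remainder, 0 when \<open>x \<le> m\<close>.\<close>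
    then have "x = min x m + (x - m)" "min x m \<in> {..m}" "x - m \<in> {..n}" by auto
    then show "x \<in> {..m} + {..n}" by (metis set_plus_intro)
  qed
qed (auto simp: set_plus_def)

text \<open>The element 0 of \<open>A\<close> already yields the lower half \<open>{..n}\<close>,
  and the element \<open>n\<close> yields everything from \<open>n\<close> to
  \<open>n + n\<close>.\<close>

lemma atMost_absorbs:
  fixes A :: "nat set"
  assumes "0 \<in> A" "n \<in> A" "A \<subseteq> {..n}"
  shows "A + {..n} = {..n + n}"
proof
  show "A + {..n} \<subseteq> {..n + n}"
    using set_plus_mono2[OF assms(3) order_refl] atMost_set_plus by blast
next
  show "{..n + n} \<subseteq> A + {..n}"
  proof
    fix x assume x: "x \<in> {..n + n}"
    show "x \<in> A + {..n}"
    proof (cases "x \<le> n")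
      case True
      then show ?thesis using set_plus_intro[OF assms(1), of x "{..n}"] by simp
    next
      case False
      then show ?thesis using set_plus_intro[OF assms(2), of "x - n" "{..n}"] x by simp
    qed
  qed
qed

section \<open>The element \<open>{0, 1}\<close>: irreducible but not prime\<close>

lemma pair_0_1_eq_atMost: "{0, 1} = {..1::nat}"
  by auto

text \<open>Copies of \<open>{0, 1}\<close> are peeled off the interval one at a time. The successor
  ensures that at least one copy is present.\<close>

lemma prime_divides_pair_0_1:
  assumes "prime Pfin P" "P divides\<^bsub>Pfin\<^esub> {..Suc n}"
  shows "P divides\<^bsub>Pfin\<^esub> {0, 1}"
  using assms(2)
proof (induction n)
  case 0
  then show ?case unfolding pair_0_1_eq_atMost by simp
next
  case (Suc n)
  have "{..Suc (Suc n)} = {..Suc n} + {0, 1}"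
    unfolding pair_0_1_eq_atMost atMost_set_plus by simp
  with Suc show ?case using prime_PfinD[OF assms(1), of "{..Suc n}" "{0, 1}"] by auto
qed

text \<open>Each summand lies inside the sum because the other contains 0. They cannot both contain
  1, as 2 is missing from the sum, and one of them must.\<close>

lemma set_plus_eq_pair_0_1D:
  fixes A B :: "nat set"
  assumes "0 \<in> A" "0 \<in> B" "A + B = {0, 1}"
  shows "A = {0, 1} \<and> B = {0} \<or> A = {0} \<and> B = {0, 1}"
proof -
  have sub: "A \<subseteq> {0, 1}" "B \<subseteq> {0, 1}"
    using set_zero_plus2[OF assms(1), of B] set_zero_plus2[OF assms(2), of A] assms(3)
    by (simp_all add: add.commute)
  have "\<not> (1 \<in> A \<and> 1 \<in> B)"
    using set_plus_intro[of 1 A 1 B] assms(3) by auto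
  moreover have "1 \<in> A \<or> 1 \<in> B"
  proof (rule ccontr)
    assume "\<not> ?thesis"
    then have "A = {0}" "B = {0}" using sub assms by auto
    then show False using assms(3) by auto
  qed
  ultimately show ?thesis using sub assms(1,2) by auto
qed

lemma not_prime_pair_0_1: "\<not> prime Pfin {0, 1}"
proof
  \<comment> \<open>Every \<open>a\<close> in \<open>A\<close> is \<open>c\<close> or
    \<open>c + 1\<close> for some \<open>c\<close> in the cofactor, and the other of these two
    numbers is in \<open>A\<close> as well.\<close>
  have isolated: "Suc a \<in> A \<or> (\<exists>b\<in>A. a = Suc b)"
    if "{0, 1} divides\<^bsub>Pfin\<^esub> A" "a \<in> A" for a A
    using that by (fastforce simp: divides_Pfin set_plus_def)
  assume "prime Pfin {0, 1}"
  moreover have "{0, 1, 3} + {0, 2, 3} = {0, 1} + {..5::nat}"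
  proof -
    have "{..6::nat} = {0, 1, 2, 3, 4, 5, 6}" by auto
    also have "\<dots> = {0, 1, 3} + {0, 2, 3}"
      unfolding set_plus_def by (simp add: Collect_disj_eq insert_commute eval_nat_numeral)
    finally have "{0, 1, 3} + {0, 2, 3} = {..6::nat}" ..
    then show ?thesis unfolding pair_0_1_eq_atMost atMost_set_plus by simp
  qed
  ultimately have "{0, 1} divides\<^bsub>Pfin\<^esub> {0, 1, 3} \<or> {0, 1} divides\<^bsub>Pfin\<^esub> {0, 2, 3}"
    by (intro prime_PfinD) (auto simp: divides_Pfin)
  \<comment> \<open>The number 3 has no neighbour in \<open>{0, 1, 3}\<close>, and 0 has none in
    \<open>{0, 2, 3}\<close>.\<close>
  then show False using isolated[of "{0, 1, 3}" 3] isolated[of "{0, 2, 3}" 0] by auto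
qed

section \<open>Uniqueness of the prime\<close>

lemma prime_Pfin_eq_1:
  assumes "finite P" "P \<noteq> {}" and prime: "prime Pfin P"
  shows "P = {1}"
proof -
  have ne: "P \<noteq> {0}" using prime by (auto simp: prime_def Units_Pfin)
  have "0 \<notin> P"
  proof
    assume 0: "0 \<in> P"
    obtain n where n: "n \<in> P" "P \<subseteq> {..n}"
      using assms Max_in Max_ge by (metis atMost_iff subsetI)
    \<comment> \<open>If \<open>n\<close> were 0, then \<open>P\<close> would be \<open>{0}\<close>;
      hence the interval up to \<open>n + n\<close> has the successor form needed for the descent to
      \<open>{0, 1}\<close>.\<close>
    with 0 ne obtain m where m: "n + n = Suc m" by (cases n) auto
    have "P divides\<^bsub>Pfin\<^esub> {..Suc m}"
      using atMost_absorbs[OF 0 n] unfolding divides_Pfin m by (metis finite_atMost not_empty_eq_Iic_eq_empty)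
    then have "P divides\<^bsub>Pfin\<^esub> {0, 1}" by (rule prime_divides_pair_0_1[OF prime])
    then obtain C where C: "{0, 1} = P + C" by (auto simp: divides_Pfin)
    then have "0 \<in> P + C" by blast
    then have "0 \<in> C" by (auto simp: set_plus_def)
    then have "P = {0, 1}" using set_plus_eq_pair_0_1D[OF 0 _ C[symmetric]] ne by blast
    with prime not_prime_pair_0_1 show False by simp
  qed
  then have "{1} divides\<^bsub>Pfin\<^esub> P"
    using assms by (subst singleton_divides_Pfin) (auto simp: Suc_le_eq intro!: gr0I)
  then obtain C where C: "finite C" "C \<noteq> {}" "P = {1} + C" by (auto simp: divides_Pfin)
  \<comment> \<open>Primality is applied to the factorization of \<open>P\<close> itself.\<close>
  have "P divides\<^bsub>Pfin\<^esub> ({1} + C)"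
    unfolding C(3)[symmetric] divides_Pfin by (intro exI[of _ "{0}"]) auto
  then consider "P divides\<^bsub>Pfin\<^esub> {1}" | "P divides\<^bsub>Pfin\<^esub> C"
    using prime_PfinD[OF prime, of "{1}" C] C by auto
  then show ?thesis
  proof cases
    case 1
    then obtain D where D: "D \<noteq> {}" "{1} = P + D" by (auto simp: divides_Pfin)
    have "p = 1" if "p \<in> P" for p
    proof -
      obtain d where "d \<in> D" using D by blast
      then have "p + d = 1" using D(2) set_plus_intro[OF that] by blast
      then show ?thesis using \<open>0 \<notin> P\<close> that by (cases p) auto
    qed
    then show ?thesis using assms by blast
  next
    case 2
    then obtain D where D: "D \<noteq> {}" "finite D" "C = P + D" by (auto simp: divides_Pfin)
    \<comment> \<open>This equation is impossible: the least element of \<open>C\<close> would be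
      strictly larger than some element of \<open>C\<close>.\<close>
    have "C = {1} + (C + D)" using C(3) D(3) by (metis add.assoc)
    then have "Min C \<in> {1} + (C + D)" using Min_in[OF C(1,2)] by (rule subst)
    then obtain c d where "c \<in> C" "Min C = 1 + (c + d)"
      by (auto elim!: set_plus_elim)
    then show ?thesis using Min_le[OF C(1), of c] by simp
  qed
qed

section \<open>Direct decompositions of \<open>Pfin0\<close>\<close>

lemma atMost_in_submonoid:
  assumes "submonoid H Pfin0" "{0, 1} \<in> H"
  shows "{..n} \<in> H"
proof (induction n)
  case 0
  then show ?case using submonoid.one_closed[OF assms(1)] by simp
next
  case (Suc n)
  have "{..Suc n} = {..n} + {0, 1}"
    unfolding pair_0_1_eq_atMost atMost_set_plus by simp
  then show ?case using submonoid.m_closed[OF assms(1) Suc assms(2)] by simp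
qed

lemma internal_direct_sum_decompose:
  assumes "internal_direct_sum G H K" "x \<in> carrier G"
  obtains h k where "h \<in> H" "k \<in> K" "x = h \<otimes>\<^bsub>G\<^esub> k"
proof -
  have "\<exists>!p. p \<in> H \<times> K \<and> x = fst p \<otimes>\<^bsub>G\<^esub> snd p"
    using assms by (simp add: internal_direct_sum_def)
  then obtain p where "p \<in> H \<times> K \<and> x = fst p \<otimes>\<^bsub>G\<^esub> snd p" by (rule ex1E)
  then show thesis by (intro that[of "fst p" "snd p"]) auto
qed

lemma internal_direct_sum_unique:
  assumes "internal_direct_sum G H K" "h \<in> H" "k \<in> K" "h' \<in> H" "k' \<in> K"
    "h \<otimes>\<^bsub>G\<^esub> k = h' \<otimes>\<^bsub>G\<^esub> k'" "h \<otimes>\<^bsub>G\<^esub> k \<in> carrier G"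
  shows "h = h' \<and> k = k'"
proof -
  have "\<exists>!p. p \<in> H \<times> K \<and> h \<otimes>\<^bsub>G\<^esub> k = fst p \<otimes>\<^bsub>G\<^esub> snd p"
    using assms by (simp add: internal_direct_sum_def)
  then have "(h, k) = (h', k')" by (rule ex1E) (use assms in \<open>metis SigmaI fst_conv snd_conv\<close>)
  then show ?thesis by simp
qed

text \<open>This symmetry allows assuming that \<open>{0, 1}\<close> lies in the first
  summand.\<close>

lemma internal_direct_sum_commute:
  assumes "internal_direct_sum Pfin0 H K"
  shows "internal_direct_sum Pfin0 K H"
proof -
  have "\<exists>!p. p \<in> K \<times> H \<and> A = fst p + snd p" if "\<exists>!p. p \<in> H \<times> K \<and> A = fst p + snd p" for A
    using that
  proof (rule ex1E)
    fix p
    assume p: "p \<in> H \<times> K \<and> A = fst p + snd p"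
      and uniq: "\<forall>q. q \<in> H \<times> K \<and> A = fst q + snd q \<longrightarrow> q = p"
    show ?thesis
    proof (rule ex1I[of _ "prod.swap p"])
      show "prod.swap p \<in> K \<times> H \<and> A = fst (prod.swap p) + snd (prod.swap p)"
        using p add.commute[of "fst p" "snd p"] by (cases p) simp
    next
      fix q assume "q \<in> K \<times> H \<and> A = fst q + snd q"
      then have "prod.swap q \<in> H \<times> K \<and> A = fst (prod.swap q) + snd (prod.swap q)"
        using add.commute[of "fst q" "snd q"] by (cases q) simp
      then have "prod.swap q = p" by (rule uniq[rule_format])
      then show "q = prod.swap p" by auto
    qed
  qed
  with assms show ?thesis by (simp add: internal_direct_sum_def)
qed

lemma direct_summand_Pfin0_trivial:
  assumes sum: "internal_direct_sum Pfin0 H K" and "{0, 1} \<in> H"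
  shows "K = {{0}}"
proof -
  have H: "submonoid H Pfin0" and K: "submonoid K Pfin0"
    using sum by (auto simp: internal_direct_sum_def)
  have K0: "{0} \<in> K" using submonoid.one_closed[OF K] by simp
  have "A = {0}" if "A \<in> K" for A
  proof -
    have A: "finite A" "0 \<in> A" using submonoid.subset[OF K] that by auto
    then obtain n where n: "n \<in> A" "A \<subseteq> {..n}"
      using Max_in Max_ge by (metis atMost_iff empty_iff subsetI)
    \<comment> \<open>Both intervals lie in \<open>H\<close>, while \<open>A\<close> and
      \<open>{0}\<close> lie in \<open>K\<close>, so one element has two representations, which must
      coincide.\<close>
    have "{..n} + A = {..n + n} + {0}"
      using atMost_absorbs[OF A(2) n] by (simp add: add.commute)
    then show ?thesis
      using internal_direct_sum_unique[OF sum, of "{..n}" A "{..n + n}" "{0}"]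
        atMost_in_submonoid[OF H assms(2)] that K0 by simp
  qed
  with K0 show ?thesis by blast
qed

lemma Pfin0_directly_indecomposable:
  assumes "internal_direct_sum Pfin0 H K"
  shows "H = {{0}} \<or> K = {{0}}"
proof -
  have "{0, 1} \<in> carrier Pfin0" by simp
  then obtain A B where "A \<in> H" "B \<in> K" "{0, 1} = A \<otimes>\<^bsub>Pfin0\<^esub> B"
    by (rule internal_direct_sum_decompose[OF assms])
  then have AB: "A \<in> H" "B \<in> K" "A + B = {0, 1}" by simp_all
  have "H \<subseteq> carrier Pfin0" "K \<subseteq> carrier Pfin0"
    using assms by (simp_all add: internal_direct_sum_def submonoid.subset)
  with AB(1,2) have "0 \<in> A" "0 \<in> B" by auto
  then have "A = {0, 1} \<or> B = {0, 1}" using set_plus_eq_pair_0_1D[OF _ _ AB(3)] by auto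
  with AB(1,2) have "{0, 1} \<in> H \<or> {0, 1} \<in> K" by auto
  then show ?thesis
    using assms direct_summand_Pfin0_trivial internal_direct_sum_commute by blast
qed

theorem theorem3p1:
  shows
    "({1} \<in> carrier Pfin \<and> cancellative Pfin {1} \<and> prime Pfin {1} \<and>
      internal_direct_sum Pfin {{k} | k. k \<in> (UNIV :: nat set)} (carrier Pfin0) \<and>
      (\<forall>P\<in>carrier Pfin. prime Pfin P \<longrightarrow> P = {1}))
     \<and>
     (\<forall>H\<^sub>1 H\<^sub>2. submonoid H\<^sub>1 Pfin0 \<longrightarrow> submonoid H\<^sub>2 Pfin0 \<longrightarrow>
        internal_direct_sum Pfin0 H\<^sub>1 H\<^sub>2 \<longrightarrow> H\<^sub>1 = {{0}} \<or> H\<^sub>2 = {{0}})"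
proof (intro conjI ballI allI impI)
  show "{1} \<in> carrier Pfin" by simp
  show "cancellative Pfin {1}"
    unfolding cancellative_def mult_Pfin using singleton_set_plus_cancel by blast
  show "prime Pfin {1}" by (rule prime_Pfin_1)
  show "internal_direct_sum Pfin {{k} | k. k \<in> (UNIV :: nat set)} (carrier Pfin0)"
    by (rule Pfin_direct_sum)
  show "P = {1}" if "P \<in> carrier Pfin" "prime Pfin P" for P
    using that prime_Pfin_eq_1 by simp
  show "H\<^sub>1 = {{0}} \<or> H\<^sub>2 = {{0}}" if "internal_direct_sum Pfin0 H\<^sub>1 H\<^sub>2" for H\<^sub>1 H\<^sub>2
    using that by (rule Pfin0_directly_indecomposable)
qed

end
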